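(* Let $p\in(0,1)$, $q:=1-p$, and let a word be a sequence of $n$ i.i.d. random variables $x_0,x_1,\ldots,x_m$, $m:=n-1$, with the geometric$(p)$ distribution $\mathbb{P}(x_0=i)=pq^{i-1}$, $i\ge 1$. Let $P_n=\sum_{i=1}^{m}|x_i-x_{i-1}|+x_0+x_m+2n$ be the perimeter of the word, and let $M:=\mathbb{E}|x_1-x_0|$, $T_1:=\mathbb{E}(x_0)$. The first three moments of $P_n$ (mean, variance, and third centered moment $\mu_3(P_n)=\mathbb{E}[(P_n-\mathbb{E}P_n)^3]$, the last one up to its dominant term) are given by $$\mathbb{E}(P_n)=(n-1)M+2n+2T_1=\frac{-2+(-2-2p+2p^2)n}{p(-2+p)},$$ $$\mathbb{V}(P_n)=\frac{n\left[4(1-p)(p^4+9p^2-4p^3-10p+5)\right]+4(3p^2-5p+5)(1-p)^2}{p^2(2-p)^2(p^2+3-3p)},$$ $$\mu_3(P_n)=n\,\frac{8(1-p)\left(114-570p+1332p^2-1908p^3+1849p^4-1263p^5+616p^6-213p^7+52p^8-9p^9+p^{10}\right)}{(2-p)^3p^3(p^2-2p+2)(p^2+3-3p)^2}+\mathcal{O}(1).$$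
   Context: $\mathbb{E}$ denotes expectation and $\mathbb{V}$ denotes variance. The quantity $P_n$ is the number of edges of the perimeter of the word of $n$ letters seen as a polyomino whose consecutive columns have heights $x_0,\ldots,x_m$. The term $\mathcal{O}(1)$ is with respect to $n$.
   Formalization: The variance formula is proved for n ≥ 2 only; for n = 1 it is false for every p, since P_1 = 2x_0 + 2 has variance 4(1-p)/p^2 (8 at p = 1/2, where the formula gives about 6.98). *)

theory Defs
  imports "HOL-Probability.Probability" "HOL-Library.Landau_Symbols"
begin

text \<open>
  A word of \<open>n\<close> letters: \<open>x 0, \<dots>, x (n - 1)\<close> are i.i.d. on the probability space \<open>M\<close>,
  geometric on \<open>{1, 2, \<dots>}\<close>. The probabilities of the values \<open>k \<ge> 1\<close> sum to 1, so the value 0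
  has probability 0. The library's \<open>geometric_pmf\<close> is the law of \<open>x i - 1\<close>. Only the indices
  \<open>i < n\<close> are constrained.
\<close>

definition geometric_word :: "real \<Rightarrow> nat \<Rightarrow> 'a measure \<Rightarrow> (nat \<Rightarrow> 'a \<Rightarrow> nat) \<Rightarrow> bool" where
  "geometric_word p n M x \<longleftrightarrow>
     prob_space M \<and>
     prob_space.indep_vars M (\<lambda>_. count_space UNIV) x {..<n} \<and>
     (\<forall>i<n. \<forall>k\<ge>1. \<P>(\<omega> in M. x i \<omega> = k) = p * (1 - p) ^ (k - 1))"

text \<open>
  The number of boundary edges of the polyomino with consecutive column heights
  \<open>x 0, \<dots>, x (n - 1)\<close>, for \<open>n \<ge> 1\<close>: \<open>2 n\<close> horizontal edges, the two outer sides, and the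
  exposed part \<open>\<bar>x i - x (i - 1)\<bar>\<close> between neighbouring columns.
\<close>

definition perimeter :: "nat \<Rightarrow> (nat \<Rightarrow> nat) \<Rightarrow> real" where
  "perimeter n x =
     (\<Sum>i=1..n-1. \<bar>real (x i) - real (x (i - 1))\<bar>) + real (x 0) + real (x (n - 1)) + 2 * real n"

definition third_centered_moment :: "'a measure \<Rightarrow> ('a \<Rightarrow> real) \<Rightarrow> real" where
  "third_centered_moment M X =
     prob_space.expectation M (\<lambda>\<omega>. (X \<omega> - prob_space.expectation M X) ^ 3)"

end

theory Submission
  imports Defs
begin

text \<open>
  With \<open>S\<^sub>m = x\<^sub>0 + \<Sum>\<^sub>i max(x\<^sub>i - x\<^sub>i\<^sub>-\<^sub>1, 0)\<close> the perimeter is \<open>P\<^sub>n = 2 n + 2 S\<^sub>m\<close>, \<open>m = n - 1\<close>. The geometric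
  law is memoryless, so for \<open>r \<ge> 1\<close> the conditional expectation of
  \<open>max(x\<^sub>m\<^sub>+\<^sub>1 - x\<^sub>m, 0)\<^sup>r q\<^sup>a\<^sup>x\<close>, \<open>x = x\<^sub>m\<^sub>+\<^sub>1\<close>, given the past is a constant times the power of \<open>q\<close> with exponent
  \<open>(a + 1) x\<^sub>m\<close>. Hence the mixed moments \<open>E(S\<^sub>m\<^sup>r q\<^sup>a\<^sup>x)\<close>, \<open>x = x\<^sub>m\<close>, satisfy a closed recursion in \<open>m\<close>, which raises \<open>a\<close>
  while it lowers \<open>r\<close>. As the increments of \<open>S\<close> are 1-dependent, the second and third
  cumulants of \<open>S\<^sub>m\<close> grow by a constant from \<open>m = 1\<close> and \<open>m = 2\<close> on, respectively.
\<close>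

section \<open>Power-weighted geometric series\<close>

definition geo_series :: "nat \<Rightarrow> real \<Rightarrow> real" where
  "geo_series r t = (\<Sum>k. real (Suc k) ^ r * t ^ k)"

text \<open>Termwise differentiation turns the coefficients \<open>k ^ r\<close> into
  \<open>(k + 1) ^ (r + 1)\<close> and keeps the radius of convergence 1. Multiplying by
  \<open>t\<close> shifts the index back, which closes the induction on the exponent.\<close>

lemma summable_geo_series:
  fixes t :: real
  assumes "\<bar>t\<bar> < 1"
  shows "summable (\<lambda>k. real (Suc k) ^ r * t ^ k)"
proof -
  have *: "summable (\<lambda>k. real k ^ r * t ^ k)" if "norm t < 1" for r and t :: real
    using that
  proof (induction r arbitrary: t)
    case 0
    then show ?case by (simp add: summable_geometric)
  next
    case (Suc r)
    have "summable (\<lambda>k. diffs (\<lambda>k. real k ^ r) k * t ^ k)"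
      by (rule termdiff_converges[OF Suc.prems Suc.IH])
    then have "summable (\<lambda>k. t * (diffs (\<lambda>k. real k ^ r) k * t ^ k))"
      by (rule summable_mult)
    also have "(\<lambda>k. t * (diffs (\<lambda>k. real k ^ r) k * t ^ k)) = (\<lambda>k. real (Suc k) ^ Suc r * t ^ Suc k)"
      by (simp add: diffs_def fun_eq_iff algebra_simps)
    finally show ?case
      by (subst (asm) summable_Suc_iff)
  qed
  show ?thesis
  proof (cases r)
    case 0
    then show ?thesis using assms by (simp add: summable_geometric)
  next
    case (Suc s)
    have "summable (\<lambda>k. diffs (\<lambda>k. real k ^ s) k * t ^ k)"
      by (rule termdiff_converges[of _ 1]) (use assms * in auto)
    then show ?thesis using Suc by (simp add: diffs_def)
  qed
qed

text \<open>Expanding \<open>(k + 2) ^ r\<close> around \<open>k + 1\<close> by the binomial theorem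
  expresses the series without its first term 1 as \<open>t\<close> times a combination of the
  series of exponents up to \<open>r\<close>. The equation is then solved for the one of exponent
  \<open>r\<close>.\<close>

lemma geo_series_rec:
  fixes t :: real
  assumes "\<bar>t\<bar> < 1"
  shows "geo_series r t = (1 + t * (\<Sum>i<r. real (r choose i) * geo_series i t)) / (1 - t)"
proof -
  have sums: "(\<lambda>k. real (Suc k) ^ i * t ^ k) sums geo_series i t" for i
    unfolding geo_series_def by (rule summable_sums[OF summable_geo_series[OF assms]])
  have "(\<lambda>k. t * (\<Sum>i\<le>r. real (r choose i) * (real (Suc k) ^ i * t ^ k)))
      sums (t * (\<Sum>i\<le>r. real (r choose i) * geo_series i t))"
    by (intro sums_mult sums_sum sums)
  moreover have "t * (\<Sum>i\<le>r. real (r choose i) * (real (Suc k) ^ i * t ^ k))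
      = real (Suc (Suc k)) ^ r * t ^ Suc k" for k
    using binomial_ring[of "real (Suc k)" 1 r]
    by (simp add: sum_distrib_left sum_distrib_right mult_ac add_ac)
  ultimately have "(\<lambda>k. real (Suc (Suc k)) ^ r * t ^ Suc k)
      sums (t * (\<Sum>i\<le>r. real (r choose i) * geo_series i t))"
    by (simp only:)
  then have "(\<lambda>k. real (Suc k) ^ r * t ^ k)
      sums (t * (\<Sum>i\<le>r. real (r choose i) * geo_series i t) + 1)"
    by (subst (asm) sums_Suc_iff) simp
  then have "geo_series r t = t * (\<Sum>i\<le>r. real (r choose i) * geo_series i t) + 1"
    using sums sums_unique2 by blast
  also have "(\<Sum>i\<le>r. real (r choose i) * geo_series i t)
      = (\<Sum>i<r. real (r choose i) * geo_series i t) + geo_series r t"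
    by (simp flip: lessThan_Suc_atMost)
  finally show ?thesis
    using assms by (simp add: field_simps)
qed

text \<open>The numerators are the Eulerian polynomials.\<close>

lemma geo_series_values:
  fixes t :: real
  assumes "\<bar>t\<bar> < 1"
  shows "geo_series 0 t = 1 / (1 - t)"
    and "geo_series 1 t = 1 / (1 - t)^2"
    and "geo_series 2 t = (1 + t) / (1 - t)^3"
    and "geo_series 3 t = (1 + 4 * t + t^2) / (1 - t)^4"
proof -
  have [simp]: "t \<noteq> 1" using assms by auto
  show 0: "geo_series 0 t = 1 / (1 - t)"
    using geo_series_rec[OF assms, of 0] by simp
  show 1: "geo_series 1 t = 1 / (1 - t)^2"
    using geo_series_rec[OF assms, of 1] by (simp add: 0 field_simps power2_eq_square)
  have "geo_series 2 t = (1 + t * (geo_series 0 t + 2 * geo_series 1 t)) / (1 - t)"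
    using geo_series_rec[OF assms, of 2] by (simp add: numeral_2_eq_2)
  also have "\<dots> = (1 + t) / (1 - t)^3"
    unfolding 0 1 by (simp add: divide_simps) (simp add: eval_nat_numeral algebra_simps)
  finally show 2: "geo_series 2 t = (1 + t) / (1 - t)^3" .
  have "geo_series 3 t
      = (1 + t * (geo_series 0 t + 3 * geo_series 1 t + 3 * geo_series 2 t)) / (1 - t)"
    using geo_series_rec[OF assms, of 3] by (simp add: numeral_3_eq_3 numeral_2_eq_2)
  also have "\<dots> = (1 + 4 * t + t^2) / (1 - t)^4"
    unfolding 0 1 2 by (simp add: divide_simps) (simp add: eval_nat_numeral algebra_simps)
  finally show "geo_series 3 t = (1 + 4 * t + t^2) / (1 - t)^4" .
qed

section \<open>Moments of a letter, and the perimeter as a total ascent\<close>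

text \<open>The expectation of \<open>X\<^sup>r q\<^sup>a\<^sup>X\<close> for a letter \<open>X\<close>, where \<open>q = 1 - p\<close>.\<close>

definition geo_moment :: "real \<Rightarrow> nat \<Rightarrow> nat \<Rightarrow> real" where
  "geo_moment p r a = p * (1 - p) ^ a * geo_series r ((1 - p) ^ Suc a)"

definition geo_letter :: "real \<Rightarrow> nat pmf" where
  "geo_letter p = map_pmf Suc (geometric_pmf p)"

text \<open>The expectation of \<open>S\<^sub>m\<^sup>r q\<^sup>a\<^sup>x\<close>, \<open>x = x\<^sub>m\<close>, see \<open>nn_integral_ascent\<close> below.\<close>

fun ascent_moment :: "real \<Rightarrow> nat \<Rightarrow> nat \<Rightarrow> nat \<Rightarrow> real" where
  "ascent_moment p 0 r a = geo_moment p r a"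
| "ascent_moment p (Suc m) r a = geo_moment p 0 a * ascent_moment p m r 0
    + (\<Sum>i=1..r. real (r choose i) * geo_moment p i a * ascent_moment p m (r - i) (Suc a))"

text \<open>Since \<open>\<bar>a - b\<bar> = 2 max(a - b, 0) - a + b\<close>, half the vertical perimeter is the total ascent of
  the word, started from height 0. The truncated subtraction of \<^typ>\<open>nat\<close> is the positive part.\<close>

definition ascent :: "nat \<Rightarrow> (nat \<Rightarrow> nat) \<Rightarrow> nat" where
  "ascent m y = y 0 + (\<Sum>i=1..m. y i - y (i - 1))"

text \<open>The signed differences telescope: together with the outer sides \<open>y 0\<close> and
  \<open>y m\<close> they supply what each absolute value lacks to be twice a positive part.\<close>

lemma perimeter_Suc_eq_ascent:
  "perimeter (Suc m) y = 2 * real (Suc m) + 2 * real (ascent m y)"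
proof -
  have "(\<Sum>i=1..m. \<bar>real (y i) - real (y (i - 1))\<bar>) + real (y 0) + real (y m) = 2 * real (ascent m y)"
  proof (induction m)
    case 0
    then show ?case by (simp add: ascent_def)
  next
    case (Suc m)
    have "ascent (Suc m) y = ascent m y + (y (Suc m) - y m)"
      by (simp add: ascent_def)
    moreover have "\<bar>real (y (Suc m)) - real (y m)\<bar> + real (y (Suc m)) - real (y m)
        = 2 * real (y (Suc m) - y m)"
      by (simp add: of_nat_diff_if)
    ultimately show ?case using Suc by simp
  qed
  then show ?thesis
    by (simp add: perimeter_def)
qed

section \<open>Closed forms for one letter\<close>

locale geometric_parameter =
  fixes p q :: real
  assumes p: "0 < p" "p < 1" and q: "q = 1 - p"
begin

lemma q_bounds: "0 < q" "q < 1"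
  using p q by auto

lemma abs_q_power: "\<bar>q ^ Suc a\<bar> < 1"
  using q_bounds power_Suc_less_one[of q a] by (simp del: power_Suc)

lemma geo_moment_sums:
  "(\<lambda>k. real (Suc k) ^ r * q ^ (a * Suc k) * (p * q ^ k)) sums geo_moment p r a"
proof -
  have "(\<lambda>k. p * q ^ a * (real (Suc k) ^ r * (q ^ Suc a) ^ k)) sums geo_moment p r a"
    unfolding geo_moment_def geo_series_def q[symmetric]
    by (intro sums_mult summable_sums summable_geo_series abs_q_power)
  moreover have "p * q ^ a * (real (Suc k) ^ r * (q ^ Suc a) ^ k)
      = real (Suc k) ^ r * q ^ (a * Suc k) * (p * q ^ k)" for k
    by (simp add: power_add power_mult power_mult_distrib del: of_nat_Suc)
  ultimately show ?thesis by (simp only:)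
qed

lemma geo_moment_nonneg: "0 \<le> geo_moment p r a"
  using sums_le[OF _ sums_zero geo_moment_sums] p q_bounds by simp

text \<open>Memorylessness: the terms with \<open>k < j\<close> vanish, since a truncated difference
  0 is raised to a positive power. Shifting the rest by \<open>j\<close> reproduces the series of a
  fresh letter, with a factor \<open>q ^ j\<close> from the law and \<open>q ^ (a * j)\<close> from
  the weight.\<close>

lemma geo_excess_sums:
  assumes "r > 0"
  shows "(\<lambda>k. real (Suc k - j) ^ r * q ^ (a * Suc k) * (p * q ^ k))
    sums (q ^ (Suc a * j) * geo_moment p r a)"
proof -
  let ?f = "\<lambda>k. real (Suc k - j) ^ r * q ^ (a * Suc k) * (p * q ^ k)"
  have "(\<lambda>k. q ^ (Suc a * j) * (real (Suc k) ^ r * q ^ (a * Suc k) * (p * q ^ k)))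
      sums (q ^ (Suc a * j) * geo_moment p r a)"
    by (intro sums_mult geo_moment_sums)
  moreover have "q ^ (Suc a * j) * (real (Suc k) ^ r * q ^ (a * Suc k) * (p * q ^ k)) = ?f (k + j)" for k
    by (simp add: power_add algebra_simps Suc_diff_le)
  ultimately have "(\<lambda>k. ?f (k + j)) sums (q ^ (Suc a * j) * geo_moment p r a)"
    by (simp only:)
  moreover have "?f k = 0" if "k < j" for k
    using assms that by simp
  ultimately show ?thesis
    by (subst (asm) sums_zero_iff_shift)
qed

text \<open>Nonnegative integrals are used throughout the recursion, so that finiteness and the
  value come out of one convergent series.\<close>

lemma nn_integral_geo_letter:
  assumes "\<And>k. 0 \<le> f k" "(\<lambda>k. f (Suc k) * (p * q ^ k)) sums s"
  shows "(\<integral>\<^sup>+k. ennreal (f k) \<partial>measure_pmf (geo_letter p)) = ennreal s"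
proof -
  have "(\<integral>\<^sup>+k. ennreal (f k) \<partial>measure_pmf (geo_letter p))
      = (\<Sum>k. ennreal (q ^ k * p) * ennreal (f (Suc k)))"
    using p unfolding geo_letter_def nn_integral_map_pmf
    by (simp add: nn_integral_measure_pmf nn_integral_count_space_nat q)
  also have "\<dots> = (\<Sum>k. ennreal (f (Suc k) * (p * q ^ k)))"
    using p q_bounds assms(1) by (subst ennreal_mult[symmetric]) (auto simp: mult_ac)
  also have "\<dots> = ennreal s"
    using assms p q_bounds by (intro suminf_ennreal_eq) auto
  finally show ?thesis .
qed

lemma ascent_moment_nonneg: "0 \<le> ascent_moment p m r a"
  by (induction m arbitrary: r a) (simp_all add: geo_moment_nonneg sum_nonneg)

text \<open>Completing the squares leaves 3/4 and 1. The two factors come from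
  \<open>1 - q ^ 3\<close> and \<open>1 - q ^ 4\<close>, divided by \<open>p\<close> and by
  \<open>p * (2 - p)\<close>.\<close>

lemma denom_pos: "0 < p^2 + 3 - 3 * p" "0 < p^2 - 2 * p + 2"
  using zero_le_power2[of "p - 1"] zero_le_power2[of "p - 3/2"]
  by (simp_all add: power2_eq_square algebra_simps)

text \<open>These are the pairs with r + a at most 3, all that the first three moments of the ascent
  can reach: the recursion raises \<open>a\<close> by one only when it lowers the power.\<close>

lemma geo_moment_values:
  shows "geo_moment p 0 0 = 1"
    and "geo_moment p 0 (Suc 0) = q / (2 - p)"
    and "geo_moment p 0 2 = q^2 / (p^2 + 3 - 3 * p)"
    and "geo_moment p 0 3 = q^3 / ((2 - p) * (p^2 - 2 * p + 2))"
    and "geo_moment p (Suc 0) 0 = 1 / p"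
    and "geo_moment p (Suc 0) (Suc 0) = q / (p * (2 - p)^2)"
    and "geo_moment p (Suc 0) 2 = q^2 / (p * (p^2 + 3 - 3 * p)^2)"
    and "geo_moment p 2 0 = (2 - p) / p^2"
    and "geo_moment p 2 (Suc 0) = q * (1 + q^2) / (p^2 * (2 - p)^3)"
    and "geo_moment p 3 0 = (1 + 4 * q + q^2) / p^3"
proof -
  have pos: "0 < p" "0 < 2 - p" using p by auto
  have q2: "1 - q^2 = p * (2 - p)" and q3: "1 - q^3 = p * (p^2 + 3 - 3 * p)"
    and q4: "1 - q^4 = p * ((2 - p) * (p^2 - 2 * p + 2))"
    by (simp_all add: q eval_nat_numeral algebra_simps)
  note series = geo_series_values[OF abs_q_power]
  have e0: "geo_moment p 0 a = p * q ^ a / (1 - q ^ Suc a)"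
    and e1: "geo_moment p (Suc 0) a = p * q ^ a / (1 - q ^ Suc a)^2"
    and e2: "geo_moment p 2 a = p * q ^ a * (1 + q ^ Suc a) / (1 - q ^ Suc a)^3"
    and e3: "geo_moment p 3 a = p * q ^ a * (1 + 4 * q ^ Suc a + (q ^ Suc a)^2) / (1 - q ^ Suc a)^4" for a
    unfolding geo_moment_def q[symmetric] One_nat_def[symmetric] series by simp_all
  have Suc: "Suc (Suc 0) = 2" "Suc 2 = 3" "Suc 3 = 4" by simp_all
  have q1: "1 - q = p" "1 + q = 2 - p" using q by auto
  show "geo_moment p 0 0 = 1"
    and "geo_moment p 0 (Suc 0) = q / (2 - p)"
    and "geo_moment p 0 2 = q^2 / (p^2 + 3 - 3 * p)"
    and "geo_moment p 0 3 = q^3 / ((2 - p) * (p^2 - 2 * p + 2))"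
    and "geo_moment p (Suc 0) 0 = 1 / p"
    and "geo_moment p (Suc 0) (Suc 0) = q / (p * (2 - p)^2)"
    and "geo_moment p (Suc 0) 2 = q^2 / (p * (p^2 + 3 - 3 * p)^2)"
    and "geo_moment p 2 0 = (2 - p) / p^2"
    and "geo_moment p 2 (Suc 0) = q * (1 + q^2) / (p^2 * (2 - p)^3)"
    and "geo_moment p 3 0 = (1 + 4 * q + q^2) / p^3"
    unfolding e0 e1 e2 e3 Suc q2 q3 q4 power_one_right power_0 q1
    using pos by (simp_all add: power_mult_distrib q1 eval_nat_numeral)
qed

lemma ascent_moment_0 [simp]: "ascent_moment p m 0 a = geo_moment p 0 a"
  by (induction m arbitrary: a) (simp_all add: geo_moment_values)

lemma ascent_moment_Suc:
  shows "ascent_moment p (Suc m) (Suc 0) a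
      = geo_moment p 0 a * ascent_moment p m (Suc 0) 0 + geo_moment p (Suc 0) a * geo_moment p 0 (Suc a)"
    and "ascent_moment p (Suc m) 2 a
      = geo_moment p 0 a * ascent_moment p m 2 0
        + 2 * geo_moment p (Suc 0) a * ascent_moment p m (Suc 0) (Suc a)
        + geo_moment p 2 a * geo_moment p 0 (Suc a)"
    and "ascent_moment p (Suc m) 3 a
      = geo_moment p 0 a * ascent_moment p m 3 0
        + 3 * geo_moment p (Suc 0) a * ascent_moment p m 2 (Suc a)
        + 3 * geo_moment p 2 a * ascent_moment p m (Suc 0) (Suc a)
        + geo_moment p 3 a * geo_moment p 0 (Suc a)"
  by (simp_all add: numeral_2_eq_2 numeral_3_eq_3)

text \<open>Each new letter exceeds its predecessor with probability
  \<open>geo_moment p 0 1 = q / (2 - p)\<close>, and the excess then has mean \<open>1 / p\<close>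
  by memorylessness.\<close>

lemma ascent_mean:
  "ascent_moment p m (Suc 0) 0 = 1 / p + real m * (q / (p * (2 - p)))"
proof (induction m)
  case 0
  then show ?case by (simp add: geo_moment_values)
next
  case (Suc m)
  then show ?case
    unfolding ascent_moment_Suc by (simp add: geo_moment_values distrib_right add_divide_distrib)
qed

section \<open>Linear growth of the second and third cumulants\<close>

definition ascent_variance :: "nat \<Rightarrow> real" where
  "ascent_variance m = ascent_moment p m 2 0 - ascent_moment p m (Suc 0) 0 ^ 2"

text \<open>The third centered moment, written in raw moments. It is also the third cumulant, whence
  its eventually linear growth.\<close>

definition ascent_third :: "nat \<Rightarrow> real" where
  "ascent_third m = ascent_moment p m 3 0
    - 3 * ascent_moment p m (Suc 0) 0 * ascent_moment p m 2 0
    + 2 * ascent_moment p m (Suc 0) 0 ^ 3"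

text \<open>One more unrolling writes the mixed moment with weight \<open>q ^ x\<close> as
  \<open>geo_moment p 0 1\<close> times an earlier mean plus a constant. Its dependence on the mean
  cancels against the growth of the squared mean.\<close>

lemma ascent_variance_step:
  "ascent_variance (Suc (Suc m)) - ascent_variance (Suc m)
    = 2 * q^3 / (p^2 * (2 - p)^2 * (p^2 + 3 - 3 * p)) + q / p^2 - 3 * q^2 / (p^2 * (2 - p)^2)"
proof -
  \<comment> \<open>\<open>c\<close> is the increment of the mean. Of the three squares subtracted
    below, two come from the mean lagging by one step and one from squaring the new mean.\<close>
  define c where "c = geo_moment p (Suc 0) 0 * geo_moment p 0 (Suc 0)"
  have "ascent_variance (Suc (Suc m)) - ascent_variance (Suc m)
    = 2 * geo_moment p (Suc 0) 0 * geo_moment p (Suc 0) (Suc 0) * geo_moment p 0 2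
      + geo_moment p 2 0 * geo_moment p 0 (Suc 0) - 3 * c^2"
    unfolding ascent_variance_def ascent_moment_Suc geo_moment_values(1) c_def
    by (simp add: power2_eq_square algebra_simps flip: numeral_2_eq_2)
  also have "\<dots> = 2 * q^3 / (p^2 * (2 - p)^2 * (p^2 + 3 - 3 * p)) + q / p^2 - 3 * q^2 / (p^2 * (2 - p)^2)"
    using p unfolding c_def geo_moment_values
    by (simp add: power2_eq_square power3_eq_cube mult_ac)
  finally show ?thesis .
qed

lemma ascent_third_step:
  "ascent_third (Suc (Suc (Suc m))) - ascent_third (Suc (Suc m))
    = (6 * q^6 / ((p^2 + 3 - 3 * p)^2 * (p^2 - 2 * p + 2))
      + (3 * q^3 * (1 + q^2) + 3 * q^3 * (2 - p)^2 - 24 * q^4) / (p^2 + 3 - 3 * p)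
      + ((1 + 4 * q + q^2) * q * (2 - p)^2 - 9 * q^2 * (2 - p)^2 + 20 * q^3)) / (p^3 * (2 - p)^3)"
proof -
  define c where "c = geo_moment p (Suc 0) 0 * geo_moment p 0 (Suc 0)"
  have Suc: "Suc (Suc 0) = 2" "Suc 2 = 3" by simp_all
  \<comment> \<open>Unrolled down to index \<open>m\<close>, both sides are polynomials in the
    moments at \<open>m\<close>, and all of these moments cancel in the difference.\<close>
  have "ascent_third (Suc (Suc (Suc m))) - ascent_third (Suc (Suc m))
    = 6 * geo_moment p (Suc 0) 0 * geo_moment p (Suc 0) (Suc 0) * geo_moment p (Suc 0) 2 * geo_moment p 0 3
      + 3 * geo_moment p (Suc 0) 0 * geo_moment p 2 (Suc 0) * geo_moment p 0 2
      + 3 * geo_moment p 2 0 * geo_moment p (Suc 0) (Suc 0) * geo_moment p 0 2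
      + geo_moment p 3 0 * geo_moment p 0 (Suc 0)
      - 24 * c * geo_moment p (Suc 0) 0 * geo_moment p (Suc 0) (Suc 0) * geo_moment p 0 2
      - 9 * c * geo_moment p 2 0 * geo_moment p 0 (Suc 0) + 20 * c^3"
    unfolding ascent_third_def ascent_moment_Suc geo_moment_values(1) c_def Suc mult_1_left
    by algebra
  also have "\<dots> = 6 * q^6 / ((p^2 + 3 - 3 * p)^2 * (p^2 - 2 * p + 2)) / (p^3 * (2 - p)^3)
      + (3 * q^3 * (1 + q^2) + 3 * q^3 * (2 - p)^2 - 24 * q^4) / (p^2 + 3 - 3 * p) / (p^3 * (2 - p)^3)
      + ((1 + 4 * q + q^2) * q * (2 - p)^2 - 9 * q^2 * (2 - p)^2 + 20 * q^3) / (p^3 * (2 - p)^3)"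
  proof -
    \<comment> \<open>Here \<open>u\<close>, \<open>w\<close> and \<open>z\<close> stand for
      \<open>2 - p\<close>, \<open>p^2 + 3 - 3 * p\<close> and \<open>p^2 - 2 * p + 2\<close>. Each
      product is brought to the common factor \<open>p^3 * u^3\<close> separately.\<close>
    have "6 * (1 / p) * (q / (p * u^2)) * (q^2 / (p * w^2)) * (q^3 / (u * z))
        = 6 * q^6 / (w^2 * z) / (p^3 * u^3)"
      and "3 * (1 / p) * (q * (1 + q^2) / (p^2 * u^3)) * (q^2 / w)
        = 3 * q^3 * (1 + q^2) / w / (p^3 * u^3)"
      and "3 * (u / p^2) * (q / (p * u^2)) * (q^2 / w) = 3 * q^3 * u^2 / w / (p^3 * u^3)"
      and "(1 + 4 * q + q^2) / p^3 * (q / u) = (1 + 4 * q + q^2) * q * u^2 / (p^3 * u^3)"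
      and "24 * (1 / p * (q / u)) * (1 / p) * (q / (p * u^2)) * (q^2 / w)
        = 24 * q^4 / w / (p^3 * u^3)"
      and "9 * (1 / p * (q / u)) * (u / p^2) * (q / u) = 9 * q^2 * u^2 / (p^3 * u^3)"
      and "20 * (1 / p * (q / u))^3 = 20 * q^3 / (p^3 * u^3)"
      if "u \<noteq> 0" for u w z
      using that p by (simp_all add: field_simps eval_nat_numeral)
    from this[of "2 - p"] show ?thesis
      unfolding c_def geo_moment_values using p
      by (simp only: add_divide_distrib diff_divide_distrib)
  qed
  finally show ?thesis by (simp only: add_divide_distrib)
qed

text \<open>The factor \<open>m + 2\<close> is the number of letters, so this is a quarter of the
  claimed variance. The line starts at two letters because \<open>ascent_variance 0\<close> does not
  lie on it.\<close>

lemma ascent_variance_eq: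
  "ascent_variance (Suc m)
    = (real (m + 2) * ((1 - p) * (p^4 + 9 * p^2 - 4 * p^3 - 10 * p + 5))
        + (3 * p^2 - 5 * p + 5) * (1 - p)^2) / (p^2 * (2 - p)^2 * (p^2 + 3 - 3 * p))"
proof (induction m)
  case 0
  have "ascent_variance (Suc 0) = (2 - p) / p^2 + 2 * (1 / p) * (q / (p * (2 - p)^2))
      + (2 - p) / p^2 * (q / (2 - p)) - (1 / p + 1 / p * (q / (2 - p)))^2"
    unfolding ascent_variance_def ascent_moment_Suc by (simp add: geo_moment_values)
  also have "\<dots> = (2 * ((1 - p) * (p^4 + 9 * p^2 - 4 * p^3 - 10 * p + 5))
        + (3 * p^2 - 5 * p + 5) * (1 - p)^2) / (p^2 * (2 - p)^2 * (p^2 + 3 - 3 * p))"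
    using p denom_pos unfolding q
    by (simp add: divide_simps) (simp add: eval_nat_numeral algebra_simps)
  finally show ?case by simp
next
  case (Suc m)
  have "2 * q^3 / (p^2 * (2 - p)^2 * (p^2 + 3 - 3 * p)) + q / p^2 - 3 * q^2 / (p^2 * (2 - p)^2)
      = (1 - p) * (p^4 + 9 * p^2 - 4 * p^3 - 10 * p + 5) / (p^2 * (2 - p)^2 * (p^2 + 3 - 3 * p))"
    using p denom_pos unfolding q
    by (simp add: divide_simps) (simp add: eval_nat_numeral algebra_simps)
  note step = ascent_variance_step[of m, unfolded this]
  have "(real (Suc m + 2) * K + C) / D = K / D + (real (m + 2) * K + C) / D" for K C D :: real
    by (simp add: add_divide_distrib distrib_right)
  with step show ?case
    by (simp only: diff_eq_eq Suc)
qed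

text \<open>The starting value \<open>ascent_third 2\<close> stays unevaluated, as it only enters
  the bounded remainder.\<close>

lemma ascent_third_eq:
  "ascent_third (Suc (Suc m)) = ascent_third 2 + real m * ((1 - p) *
      (114 - 570 * p + 1332 * p^2 - 1908 * p^3 + 1849 * p^4 - 1263 * p^5
        + 616 * p^6 - 213 * p^7 + 52 * p^8 - 9 * p^9 + p^10)
      / ((2 - p)^3 * p^3 * (p^2 - 2 * p + 2) * (p^2 + 3 - 3 * p)^2))"
proof (induction m)
  case 0
  then show ?case by (simp add: numeral_2_eq_2)
next
  case (Suc m)
  define w z where "w = p^2 + 3 - 3 * p" and "z = p^2 - 2 * p + 2"
  have wz: "w \<noteq> 0" "z \<noteq> 0" using denom_pos by (simp_all add: w_def z_def)
  have "6 * q^6 / (w^2 * z) + A / w + B = (6 * q^6 + A * (w * z) + B * (w^2 * z)) / (w^2 * z)" for A B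
    using wz by (simp add: field_simps power2_eq_square)
  note step = ascent_third_step[of m, folded w_def z_def, unfolded this]
  \<comment> \<open>Over the common denominator \<open>w^2 * z\<close> the numerator becomes a
    polynomial in \<open>p\<close> alone, the one of the theorem up to the factor 8.\<close>
  have "6 * q^6 + (3 * q^3 * (1 + q^2) + 3 * q^3 * (2 - p)^2 - 24 * q^4) * (w * z)
      + ((1 + 4 * q + q^2) * q * (2 - p)^2 - 9 * q^2 * (2 - p)^2 + 20 * q^3) * (w^2 * z)
    = (1 - p) * (114 - 570 * p + 1332 * p^2 - 1908 * p^3 + 1849 * p^4 - 1263 * p^5
        + 616 * p^6 - 213 * p^7 + 52 * p^8 - 9 * p^9 + p^10)"
    unfolding q w_def z_def by algebra
  note step = step[unfolded this]
  have *: "N / (w^2 * z) / (p^3 * (2 - p)^3) = N / ((2 - p)^3 * p^3 * z * w^2)" for N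
    by (simp add: mult_ac)
  have "a + real (Suc m) * t = t + (a + real m * t)" for a t :: real
    by (simp add: distrib_right)
  with step[unfolded *] show ?case
    by (simp only: diff_eq_eq Suc w_def z_def)
qed

section \<open>Integrating out the last letter\<close>

text \<open>Binomial expansion in the old ascent \<open>s\<close> and the excess over
  \<open>j\<close>. The term \<open>i = 0\<close> stands apart: it contains no excess, so it carries
  no factor \<open>q ^ (Suc a * j)\<close>.\<close>

lemma nn_integral_ascent_step:
  "(\<integral>\<^sup>+k. ennreal (real (s + (k - j)) ^ r * q ^ (a * k)) \<partial>measure_pmf (geo_letter p))
    = ennreal (geo_moment p 0 a * real s ^ r
        + (\<Sum>i=1..r. real (r choose i) * geo_moment p i a * (real s ^ (r - i) * q ^ (Suc a * j))))"
proof (rule nn_integral_geo_letter)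
  show "0 \<le> real (s + (k - j)) ^ r * q ^ (a * k)" for k
    using q_bounds by simp
  have "(\<lambda>k. real s ^ r * (real (Suc k) ^ 0 * q ^ (a * Suc k) * (p * q ^ k))
      + (\<Sum>i=1..r. real (r choose i) * real s ^ (r - i)
          * (real (Suc k - j) ^ i * q ^ (a * Suc k) * (p * q ^ k))))
    sums (real s ^ r * geo_moment p 0 a
      + (\<Sum>i=1..r. real (r choose i) * real s ^ (r - i) * (q ^ (Suc a * j) * geo_moment p i a)))"
    by (intro sums_add sums_mult sums_sum geo_moment_sums geo_excess_sums) auto
  moreover have "real s ^ r * (real (Suc k) ^ 0 * q ^ (a * Suc k) * (p * q ^ k))
      + (\<Sum>i=1..r. real (r choose i) * real s ^ (r - i)
          * (real (Suc k - j) ^ i * q ^ (a * Suc k) * (p * q ^ k)))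
    = real (s + (Suc k - j)) ^ r * q ^ (a * Suc k) * (p * q ^ k)" for k
  proof -
    have "real (s + (Suc k - j)) ^ r = (real (Suc k - j) + real s) ^ r"
      by (simp only: of_nat_add add.commute)
    also have "\<dots> = (\<Sum>i\<le>r. real (r choose i) * real (Suc k - j) ^ i * real s ^ (r - i))"
      by (rule binomial_ring)
    also have "\<dots> = real s ^ r + (\<Sum>i=1..r. real (r choose i) * real (Suc k - j) ^ i * real s ^ (r - i))"
      by (simp add: atMost_atLeast0 sum.atLeast_Suc_atMost)
    finally show ?thesis
      by (simp add: distrib_left sum_distrib_left mult_ac del: of_nat_Suc mult_Suc_right)
  qed
  ultimately have "(\<lambda>k. real (s + (Suc k - j)) ^ r * q ^ (a * Suc k) * (p * q ^ k)) sums
      (real s ^ r * geo_moment p 0 a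
        + (\<Sum>i=1..r. real (r choose i) * real s ^ (r - i) * (q ^ (Suc a * j) * geo_moment p i a)))"
    by (simp only:)
  then show "(\<lambda>k. real (s + (Suc k - j)) ^ r * q ^ (a * Suc k) * (p * q ^ k)) sums
      (geo_moment p 0 a * real s ^ r
        + (\<Sum>i=1..r. real (r choose i) * geo_moment p i a * (real s ^ (r - i) * q ^ (Suc a * j))))"
    by (simp only: mult_ac)
qed

end

section \<open>Moments of the ascent of a random word\<close>

locale geometric_letters = prob_space M + geometric_parameter p q
  for M :: "'a measure" and p q :: real +
  fixes x :: "nat \<Rightarrow> 'a \<Rightarrow> nat" and n :: nat
  assumes indep: "indep_vars (\<lambda>_. count_space UNIV) x {..<n}"
    and prob_letter: "i < n \<Longrightarrow> k \<ge> 1 \<Longrightarrow> \<P>(\<omega> in M. x i \<omega> = k) = p * (1 - p) ^ (k - 1)"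
begin

lemma measurable_letter: "i < n \<Longrightarrow> x i \<in> M \<rightarrow>\<^sub>M count_space UNIV"
  using indep unfolding indep_vars_def by auto

text \<open>The given masses at 1, 2, ... sum to \<open>p / (1 - q) = 1\<close>, which forces mass 0
  at the value 0. Laws on a countable set agree once they agree on singletons.\<close>

lemma distr_letter:
  assumes i: "i < n"
  shows "distr M (count_space UNIV) (x i) = measure_pmf (geo_letter p)"
proof -
  let ?D = "distr M (count_space UNIV) (x i)"
  interpret D: prob_space ?D
    by (rule prob_space_distr[OF measurable_letter[OF i]])
  have measure_Suc: "measure ?D {Suc k} = p * q ^ k" for k
    using prob_letter[OF i, of "Suc k"] i
    by (simp add: measure_distr measurable_letter q vimage_def Int_def conj_commute)
  have "(\<lambda>k. measure ?D {Suc k}) sums measure ?D (\<Union>k. {Suc k})"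
    by (rule D.finite_measure_UNION) (auto simp: disjoint_family_on_def)
  moreover have "(\<lambda>k. p * q ^ k) sums (p * (1 / (1 - q)))"
    using q_bounds by (intro sums_mult geometric_sums) simp
  ultimately have "measure ?D (\<Union>k. {Suc k}) = 1"
    using sums_unique2 p by (fastforce simp: measure_Suc q)
  moreover have "(\<Union>k. {Suc k}) = space ?D - {0}"
    using not0_implies_Suc by auto
  ultimately have zero: "measure ?D {0} = 0"
    using D.prob_compl[of "{0}"] by simp
  show ?thesis
  proof (rule measure_eqI_countable)
    show "emeasure ?D {k} = emeasure (measure_pmf (geo_letter p)) {k}" for k
    proof (cases k)
      case 0
      then show ?thesis
        using zero by (simp add: D.emeasure_eq_measure emeasure_pmf_single geo_letter_def pmf_eq_0_set_pmf)
    next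
      case (Suc l)
      then show ?thesis
        using p
        by (simp add: D.emeasure_eq_measure measure_Suc emeasure_pmf_single geo_letter_def pmf_map_inj' q)
    qed
  qed auto
qed

text \<open>The block of the first \<open>m + 1\<close> letters is independent of the next one, so
  their joint law is a product and Tonelli applies. Finite products of countable discrete spaces are
  discrete, which makes every \<open>F\<close> measurable.\<close>

lemma nn_integral_next_letter:
  fixes F :: "nat \<Rightarrow> nat \<Rightarrow> nat \<Rightarrow> ennreal"
  assumes m: "Suc m < n"
  shows "(\<integral>\<^sup>+\<omega>. F (ascent m (\<lambda>i. x i \<omega>)) (x m \<omega>) (x (Suc m) \<omega>) \<partial>M)
    = (\<integral>\<^sup>+\<omega>. \<integral>\<^sup>+k. F (ascent m (\<lambda>i. x i \<omega>)) (x m \<omega>) k \<partial>measure_pmf (geo_letter p) \<partial>M)"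
proof -
  let ?S = "count_space (PiE {..m} (\<lambda>_. UNIV :: nat set))"
    and ?T = "count_space (PiE {Suc m} (\<lambda>_. UNIV :: nat set))"
  let ?W = "\<lambda>\<omega>. restrict (\<lambda>i. x i \<omega>) {..m}" and ?V = "\<lambda>\<omega>. restrict (\<lambda>i. x i \<omega>) {Suc m}"
  let ?F = "\<lambda>(w, v). F (ascent m w) (w m) (v (Suc m))"
  have "indep_var ?S ?W ?T ?V"
    using indep_var_restrict[OF indep, of "{..m}" "{Suc m}"] m
    by (simp add: count_space_PiM_finite subset_eq)
  then have W: "?W \<in> M \<rightarrow>\<^sub>M ?S" and V: "?V \<in> M \<rightarrow>\<^sub>M ?T"
    and eq: "distr M ?S ?W \<Otimes>\<^sub>M distr M ?T ?V = distr M (?S \<Otimes>\<^sub>M ?T) (\<lambda>\<omega>. (?W \<omega>, ?V \<omega>))"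
    by (simp_all only: indep_var_distribution_eq)
  have ST: "?S \<Otimes>\<^sub>M ?T = count_space (PiE {..m} (\<lambda>_. UNIV) \<times> PiE {Suc m} (\<lambda>_. UNIV))"
    by (simp add: pair_measure_countable countable_PiE)
  interpret V: prob_space "distr M ?T ?V"
    by (rule prob_space_distr[OF V])
  have ascent: "ascent m (?W \<omega>) = ascent m (\<lambda>i. x i \<omega>)" for \<omega>
    by (auto simp: ascent_def intro!: sum.cong)
  have F: "?F \<in> borel_measurable (distr M ?S ?W \<Otimes>\<^sub>M distr M ?T ?V)"
    unfolding eq by (simp add: ST)
  have "(\<integral>\<^sup>+\<omega>. F (ascent m (\<lambda>i. x i \<omega>)) (x m \<omega>) (x (Suc m) \<omega>) \<partial>M)
      = (\<integral>\<^sup>+z. ?F z \<partial>distr M (?S \<Otimes>\<^sub>M ?T) (\<lambda>\<omega>. (?W \<omega>, ?V \<omega>)))"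
    by (subst nn_integral_distr[OF measurable_Pair[OF W V]]) (simp_all add: ST ascent)
  also have "\<dots> = (\<integral>\<^sup>+w. \<integral>\<^sup>+v. ?F (w, v) \<partial>distr M ?T ?V \<partial>distr M ?S ?W)"
    unfolding eq[symmetric] by (rule V.nn_integral_fst[OF F, symmetric])
  also have "\<dots> = (\<integral>\<^sup>+\<omega>. \<integral>\<^sup>+v. F (ascent m (\<lambda>i. x i \<omega>)) (x m \<omega>) (v (Suc m)) \<partial>distr M ?T ?V \<partial>M)"
    by (subst nn_integral_distr[OF W]) (simp_all add: ascent)
  also have "\<dots> = (\<integral>\<^sup>+\<omega>. \<integral>\<^sup>+k. F (ascent m (\<lambda>i. x i \<omega>)) (x m \<omega>) k \<partial>measure_pmf (geo_letter p) \<partial>M)"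
    unfolding distr_letter[OF m, symmetric]
    by (simp add: nn_integral_distr[OF V] nn_integral_distr[OF measurable_letter[OF m]])
  finally show ?thesis .
qed

lemma measurable_ascent:
  assumes "m < n"
  shows "(\<lambda>\<omega>. ascent m (\<lambda>i. x i \<omega>)) \<in> M \<rightarrow>\<^sub>M count_space UNIV"
proof -
  have [measurable]: "x 0 \<in> M \<rightarrow>\<^sub>M count_space UNIV"
    "\<And>i. i \<in> {1..m} \<Longrightarrow> x i \<in> M \<rightarrow>\<^sub>M count_space UNIV"
    "\<And>i. i \<in> {1..m} \<Longrightarrow> x (i - 1) \<in> M \<rightarrow>\<^sub>M count_space UNIV"
    using assms by (auto intro!: measurable_letter)
  show ?thesis
    unfolding ascent_def by measurable
qed

text \<open>Integrating out the last letter leaves powers of the earlier ascent weighted by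
  \<open>q ^ (Suc a * x m)\<close>, which are moments of the same kind. Hence the induction runs
  over all \<open>r\<close> and \<open>a\<close> at once.\<close>

lemma nn_integral_ascent:
  assumes "m < n"
  shows "(\<integral>\<^sup>+\<omega>. ennreal (real (ascent m (\<lambda>i. x i \<omega>)) ^ r * q ^ (a * x m \<omega>)) \<partial>M)
    = ennreal (ascent_moment p m r a)"
  using assms
proof (induction m arbitrary: r a)
  case 0
  then have "(\<integral>\<^sup>+\<omega>. ennreal (real (ascent 0 (\<lambda>i. x i \<omega>)) ^ r * q ^ (a * x 0 \<omega>)) \<partial>M)
      = (\<integral>\<^sup>+k. ennreal (real k ^ r * q ^ (a * k)) \<partial>measure_pmf (geo_letter p))"
    by (simp add: ascent_def nn_integral_distr measurable_letter flip: distr_letter)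
  also have "\<dots> = ennreal (geo_moment p r a)"
    using q_bounds by (intro nn_integral_geo_letter geo_moment_sums) auto
  finally show ?case by simp
next
  case (Suc m)
  let ?S = "\<lambda>\<omega>. ascent m (\<lambda>i. x i \<omega>)"
  have [measurable]: "?S \<in> M \<rightarrow>\<^sub>M count_space UNIV" "x m \<in> M \<rightarrow>\<^sub>M count_space UNIV"
    using Suc.prems by (auto intro: measurable_ascent measurable_letter)
  have [measurable]: "(\<lambda>\<omega>. q ^ (b * x m \<omega>)) \<in> borel_measurable M" for b
    by (rule measurable_compose[of "x m" _ "count_space UNIV"]) auto
  have [simp]: "0 \<le> q" using q_bounds by simp
  note [simp] = geo_moment_nonneg ascent_moment_nonneg
  have "(\<integral>\<^sup>+\<omega>. ennreal (real (ascent (Suc m) (\<lambda>i. x i \<omega>)) ^ r * q ^ (a * x (Suc m) \<omega>)) \<partial>M)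
      = (\<integral>\<^sup>+\<omega>. ennreal (real (?S \<omega> + (x (Suc m) \<omega> - x m \<omega>)) ^ r * q ^ (a * x (Suc m) \<omega>)) \<partial>M)"
    by (simp add: ascent_def add.assoc)
  also have "\<dots> = (\<integral>\<^sup>+\<omega>. \<integral>\<^sup>+k. ennreal (real (?S \<omega> + (k - x m \<omega>)) ^ r * q ^ (a * k))
      \<partial>measure_pmf (geo_letter p) \<partial>M)"
    by (rule nn_integral_next_letter[OF Suc.prems,
          of "\<lambda>s j k. ennreal (real (s + (k - j)) ^ r * q ^ (a * k))"])
  \<comment> \<open>The factor \<open>q ^ (0 * x m \<omega>)\<close> is 1. It gives the first term
    the shape of the induction hypothesis with weight exponent 0.\<close>
  also have "\<dots> = (\<integral>\<^sup>+\<omega>. ennreal (geo_moment p 0 a) * ennreal (real (?S \<omega>) ^ r * q ^ (0 * x m \<omega>))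
      + (\<Sum>i=1..r. ennreal (real (r choose i) * geo_moment p i a)
          * ennreal (real (?S \<omega>) ^ (r - i) * q ^ (Suc a * x m \<omega>))) \<partial>M)"
    unfolding nn_integral_ascent_step
    by (simp add: ennreal_plus sum_nonneg flip: ennreal_mult sum_ennreal)
  also have "\<dots> = ennreal (geo_moment p 0 a) * ennreal (ascent_moment p m r 0)
      + (\<Sum>i=1..r. ennreal (real (r choose i) * geo_moment p i a)
          * ennreal (ascent_moment p m (r - i) (Suc a)))"
    using Suc.prems by (simp add: nn_integral_add nn_integral_cmult nn_integral_sum Suc.IH Suc.IH[of _ 0, simplified]
        del: mult_0 mult_Suc power_Suc)
  also have "\<dots> = ennreal (ascent_moment p (Suc m) r a)"
    by (simp add: ennreal_plus sum_nonneg flip: ennreal_mult sum_ennreal)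
  finally show ?case .
qed

lemma has_bochner_integral_ascent_power:
  assumes "m < n"
  shows "has_bochner_integral M (\<lambda>\<omega>. real (ascent m (\<lambda>i. x i \<omega>)) ^ r) (ascent_moment p m r 0)"
  using assms nn_integral_ascent[OF assms, of r 0] measurable_ascent[OF assms]
  by (intro has_bochner_integral_nn_integral) (auto simp: ascent_moment_nonneg)

lemma has_bochner_integral_letter:
  assumes "i < n"
  shows "has_bochner_integral M (\<lambda>\<omega>. real (x i \<omega>)) (1 / p)"
proof (rule has_bochner_integral_nn_integral)
  have "(\<integral>\<^sup>+\<omega>. ennreal (real (x i \<omega>)) \<partial>M) = (\<integral>\<^sup>+k. ennreal (real k) \<partial>measure_pmf (geo_letter p))"
    using assms by (simp add: nn_integral_distr measurable_letter flip: distr_letter)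
  also have "\<dots> = ennreal (1 / p)"
    using geo_moment_sums[of 1 0] by (intro nn_integral_geo_letter) (simp_all add: geo_moment_values)
  finally show "(\<integral>\<^sup>+\<omega>. ennreal (real (x i \<omega>)) \<partial>M) = ennreal (1 / p)" .
qed (use p measurable_letter[OF assms] in auto)

lemma ascent_integrable_power:
  assumes "m < n"
  shows "integrable M (\<lambda>\<omega>. real (ascent m (\<lambda>i. x i \<omega>)) ^ r)"
    and "expectation (\<lambda>\<omega>. real (ascent m (\<lambda>i. x i \<omega>)) ^ r) = ascent_moment p m r 0"
  using has_bochner_integral_ascent_power[OF assms] by (auto simp: has_bochner_integral_iff)

section \<open>Moments of the perimeter\<close>

context
  fixes m :: nat
  assumes m: "m < n"
begin

private abbreviation S :: "'a \<Rightarrow> real" where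
  "S \<omega> \<equiv> real (ascent m (\<lambda>i. x i \<omega>))"

private lemma S_integrable: "integrable M (\<lambda>\<omega>. S \<omega> ^ r)" "integrable M S"
  using ascent_integrable_power(1)[OF m] ascent_integrable_power(1)[OF m, of 1] by auto

private lemma S_expectation:
  "expectation (\<lambda>\<omega>. S \<omega> ^ r) = ascent_moment p m r 0"
  "expectation S = ascent_moment p m (Suc 0) 0"
  using ascent_integrable_power(2)[OF m] ascent_integrable_power(2)[OF m, of 1] by auto

text \<open>A non-integrable function has integral 0 by default; this lemma makes the moments up to
  order three genuine expectations.\<close>

lemma integrable_perimeter_cube: "integrable M (\<lambda>\<omega>. perimeter (Suc m) (\<lambda>i. x i \<omega>) ^ 3)"
proof -
  have "perimeter (Suc m) (\<lambda>i. x i \<omega>) ^ 3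
      = 8 * (real (Suc m) ^ 3 + 3 * real (Suc m) ^ 2 * S \<omega> + 3 * real (Suc m) * S \<omega> ^ 2 + S \<omega> ^ 3)" for \<omega>
    unfolding perimeter_Suc_eq_ascent by algebra
  then show ?thesis
    by (simp only:) (intro integrable_mult_right Bochner_Integration.integrable_add S_integrable
        integrable_const)
qed

lemma expectation_perimeter:
  "expectation (\<lambda>\<omega>. perimeter (Suc m) (\<lambda>i. x i \<omega>))
    = 2 * real (Suc m) + 2 * ascent_moment p m (Suc 0) 0"
  unfolding perimeter_Suc_eq_ascent by (simp add: S_integrable S_expectation prob_space)

lemma centered_perimeter:
  "perimeter (Suc m) (\<lambda>i. x i \<omega>) - expectation (\<lambda>\<omega>. perimeter (Suc m) (\<lambda>i. x i \<omega>))
    = 2 * (S \<omega> - ascent_moment p m (Suc 0) 0)"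
  unfolding expectation_perimeter by (simp add: perimeter_Suc_eq_ascent)

lemma variance_perimeter:
  "variance (\<lambda>\<omega>. perimeter (Suc m) (\<lambda>i. x i \<omega>)) = 4 * ascent_variance m"
proof -
  define \<mu> where "\<mu> = ascent_moment p m (Suc 0) 0"
  have "(2 * (S \<omega> - \<mu>))^2 = 4 * (S \<omega> ^ 2 - 2 * \<mu> * S \<omega> + \<mu>^2)" for \<omega>
    by algebra
  moreover have "expectation (\<lambda>\<omega>. 4 * (S \<omega> ^ 2 - 2 * \<mu> * S \<omega> + \<mu>^2)) = 4 * ascent_variance m"
    by (simp add: S_integrable S_expectation prob_space ascent_variance_def flip: \<mu>_def)
      (simp add: power2_eq_square)
  ultimately show ?thesis
    by (simp only: centered_perimeter flip: \<mu>_def)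
qed

lemma third_centered_moment_perimeter:
  "third_centered_moment M (\<lambda>\<omega>. perimeter (Suc m) (\<lambda>i. x i \<omega>)) = 8 * ascent_third m"
proof -
  define \<mu> where "\<mu> = ascent_moment p m (Suc 0) 0"
  have "(2 * (S \<omega> - \<mu>))^3 = 8 * (S \<omega> ^ 3 - 3 * \<mu> * S \<omega> ^ 2 + 3 * \<mu>^2 * S \<omega> - \<mu>^3)" for \<omega>
    by algebra
  moreover have "expectation (\<lambda>\<omega>. 8 * (S \<omega> ^ 3 - 3 * \<mu> * S \<omega> ^ 2 + 3 * \<mu>^2 * S \<omega> - \<mu>^3))
      = 8 * ascent_third m"
    by (simp add: S_integrable S_expectation prob_space ascent_third_def flip: \<mu>_def)
      (simp add: power2_eq_square power3_eq_cube)
  ultimately show ?thesis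
    by (simp only: third_centered_moment_def centered_perimeter flip: \<mu>_def)
qed

end

text \<open>The perimeter identity for two letters expresses the gap as \<open>2 * ascent 1\<close>
  minus both letters, and the means \<open>1 / p\<close> cancel.\<close>

lemma expectation_gap:
  assumes "n \<ge> 2"
  shows "expectation (\<lambda>\<omega>. \<bar>real (x 1 \<omega>) - real (x 0 \<omega>)\<bar>) = 2 * (q / (p * (2 - p)))"
proof -
  have "\<bar>real (x 1 \<omega>) - real (x 0 \<omega>)\<bar>
      = 2 * real (ascent 1 (\<lambda>i. x i \<omega>)) ^ 1 - real (x 0 \<omega>) - real (x 1 \<omega>)" for \<omega>
    using perimeter_Suc_eq_ascent[of 1 "\<lambda>i. x i \<omega>"] by (simp add: perimeter_def)
  moreover have "has_bochner_integral M
      (\<lambda>\<omega>. 2 * real (ascent 1 (\<lambda>i. x i \<omega>)) ^ 1 - real (x 0 \<omega>) - real (x 1 \<omega>))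
      (2 * ascent_moment p 1 1 0 - 1 / p - 1 / p)"
    using assms by (intro has_bochner_integral_diff has_bochner_integral_mult_right
        has_bochner_integral_ascent_power has_bochner_integral_letter) auto
  ultimately show ?thesis
    by (simp only: has_bochner_integral_iff One_nat_def ascent_mean) simp
qed

end

section \<open>The three moments for words of every length\<close>

lemma geometric_word_letters:
  assumes "0 < p" "p < 1" "geometric_word p n M x"
  shows "geometric_letters M p (1 - p) x n"
  using assms
  by (simp add: geometric_word_def geometric_letters_def geometric_letters_axioms_def
      geometric_parameter_def)

theorem theorem4p1:
  fixes p :: real
    and \<Omega> :: "nat \<Rightarrow> 'a measure"
    and x :: "nat \<Rightarrow> nat \<Rightarrow> 'a \<Rightarrow> nat"
    and P :: "nat \<Rightarrow> 'a \<Rightarrow> real"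
  assumes p: "0 < p" "p < 1"
    and word: "\<And>n. n \<ge> 1 \<Longrightarrow> geometric_word p n (\<Omega> n) (x n)"
    and P: "\<And>n \<omega>. P n \<omega> = perimeter n (\<lambda>i. x n i \<omega>)"
  shows
    "(\<forall>n\<ge>1. integrable (\<Omega> n) (\<lambda>\<omega>. P n \<omega> ^ 3)) \<and>
     (\<forall>n\<ge>1.
        let M = prob_space.expectation (\<Omega> n) (\<lambda>\<omega>. \<bar>real (x n 1 \<omega>) - real (x n 0 \<omega>)\<bar>);
            T1 = prob_space.expectation (\<Omega> n) (\<lambda>\<omega>. real (x n 0 \<omega>))
        in prob_space.expectation (\<Omega> n) (P n) = (real n - 1) * M + 2 * real n + 2 * T1 \<and>
           (real n - 1) * M + 2 * real n + 2 * T1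
             = (- 2 + (- 2 - 2 * p + 2 * p ^ 2) * real n) / (p * (- 2 + p))) \<and>
     (\<forall>n\<ge>2.
        prob_space.variance (\<Omega> n) (P n)
          = (real n * (4 * (1 - p) * (p ^ 4 + 9 * p ^ 2 - 4 * p ^ 3 - 10 * p + 5))
              + 4 * (3 * p ^ 2 - 5 * p + 5) * (1 - p) ^ 2)
            / (p ^ 2 * (2 - p) ^ 2 * (p ^ 2 + 3 - 3 * p))) \<and>
     (\<lambda>n. third_centered_moment (\<Omega> n) (P n)
          - real n *
            (8 * (1 - p) *
               (114 - 570 * p + 1332 * p ^ 2 - 1908 * p ^ 3 + 1849 * p ^ 4 - 1263 * p ^ 5
                 + 616 * p ^ 6 - 213 * p ^ 7 + 52 * p ^ 8 - 9 * p ^ 9 + p ^ 10)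
             / ((2 - p) ^ 3 * p ^ 3 * (p ^ 2 - 2 * p + 2) * (p ^ 2 + 3 - 3 * p) ^ 2)))
       \<in> O(\<lambda>_. 1)"
proof -
  have P_eq: "P n = (\<lambda>\<omega>. perimeter n (\<lambda>i. x n i \<omega>))" for n
    using P by auto
  interpret geometric_parameter p "1 - p"
    by unfold_locales (use p in auto)
  note letters = geometric_word_letters[OF p word]
  have 1: "integrable (\<Omega> n) (\<lambda>\<omega>. P n \<omega> ^ 3)" if n: "n \<ge> 1" for n
    using geometric_letters.integrable_perimeter_cube[OF letters[OF n], of "n - 1"] n by (simp add: P_eq)
  have 2: "let M = prob_space.expectation (\<Omega> n) (\<lambda>\<omega>. \<bar>real (x n 1 \<omega>) - real (x n 0 \<omega>)\<bar>);
          T1 = prob_space.expectation (\<Omega> n) (\<lambda>\<omega>. real (x n 0 \<omega>))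
      in prob_space.expectation (\<Omega> n) (P n) = (real n - 1) * M + 2 * real n + 2 * T1 \<and>
         (real n - 1) * M + 2 * real n + 2 * T1
           = (- 2 + (- 2 - 2 * p + 2 * p ^ 2) * real n) / (p * (- 2 + p))" if n: "n \<ge> 1" for n
  proof -
    interpret geometric_letters "\<Omega> n" p "1 - p" "x n" n by (rule letters[OF n])
    have M: "(real n - 1) * expectation (\<lambda>\<omega>. \<bar>real (x n 1 \<omega>) - real (x n 0 \<omega>)\<bar>)
        = (real n - 1) * (2 * ((1 - p) / (p * (2 - p))))"
      \<comment> \<open>for \<open>n = 1\<close> the letter \<open>x 1\<close> is arbitrary, but the factor vanishes\<close>
    proof (cases "n = 1")
      case False
      then show ?thesis using n expectation_gap by simp
    qed simp
    have T1: "expectation (\<lambda>\<omega>. real (x n 0 \<omega>)) = 1 / p"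
      using has_bochner_integral_letter[of 0] n by (simp add: has_bochner_integral_iff)
    have "(real n - 1) * (2 * ((1 - p) / (p * (2 - p)))) + 2 * real n + 2 * (1 / p)
        = (- 2 + (- 2 - 2 * p + 2 * p ^ 2) * real n) / (p * (- 2 + p))"
      using p by (simp add: divide_simps) (simp add: power2_eq_square algebra_simps)
    moreover have "expectation (P n)
        = (real n - 1) * (2 * ((1 - p) / (p * (2 - p)))) + 2 * real n + 2 * (1 / p)"
      using n expectation_perimeter[of "n - 1"] unfolding P_eq ascent_mean
      by (simp add: algebra_simps)
    ultimately show ?thesis
      unfolding Let_def M T1 by simp
  qed
  have 3: "prob_space.variance (\<Omega> n) (P n)
      = (real n * (4 * (1 - p) * (p ^ 4 + 9 * p ^ 2 - 4 * p ^ 3 - 10 * p + 5))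
          + 4 * (3 * p ^ 2 - 5 * p + 5) * (1 - p) ^ 2)
        / (p ^ 2 * (2 - p) ^ 2 * (p ^ 2 + 3 - 3 * p))" if n: "n \<ge> 2" for n
  proof -
    have "n \<ge> 1" using n by simp
    then interpret geometric_letters "\<Omega> n" p "1 - p" "x n" n by (rule letters)
    have m: "Suc (Suc (n - 2)) = n" "n - 2 + 2 = n" "Suc (n - 2) < n" using n by auto
    have "4 * ((N * (a * b) + c * d) / e) = (N * (4 * a * b) + 4 * c * d) / e"
      for N a b c d e :: real
      by (simp add: distrib_left)
    then show ?thesis
      unfolding P_eq variance_perimeter[OF m(3), unfolded m(1) ascent_variance_eq m(2)] .
  qed
  define \<tau> where "\<tau> = 8 * (1 - p) *
               (114 - 570 * p + 1332 * p ^ 2 - 1908 * p ^ 3 + 1849 * p ^ 4 - 1263 * p ^ 5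
                 + 616 * p ^ 6 - 213 * p ^ 7 + 52 * p ^ 8 - 9 * p ^ 9 + p ^ 10)
             / ((2 - p) ^ 3 * p ^ 3 * (p ^ 2 - 2 * p + 2) * (p ^ 2 + 3 - 3 * p) ^ 2)"
  \<comment> \<open>A word of \<open>n\<close> letters has ascent index
    \<open>n - 1 = Suc (Suc (n - 3))\<close>, so the line has run for \<open>n - 3\<close> steps.
    From three letters on the remainder is therefore constant, and the shorter words do not affect
    the order of growth.\<close>
  have "third_centered_moment (\<Omega> n) (P n) - real n * \<tau> = 8 * ascent_third 2 - 3 * \<tau>"
    if n: "n \<ge> 3" for n
  proof -
    have "n \<ge> 1" using n by simp
    then interpret geometric_letters "\<Omega> n" p "1 - p" "x n" n by (rule letters)
    have m: "Suc (Suc (Suc (n - 3))) = n" "Suc (Suc (n - 3)) < n" "real (n - 3) = real n - 3"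
      using n by auto
    have "third_centered_moment (\<Omega> n) (P n) = 8 * ascent_third 2 + (real n - 3) * \<tau>"
      using third_centered_moment_perimeter[OF m(2)]
      unfolding m(1) P_eq ascent_third_eq m(3) \<tau>_def by simp
    then show ?thesis by (simp add: algebra_simps)
  qed
  then have "\<forall>\<^sub>F n in at_top. third_centered_moment (\<Omega> n) (P n) - real n * \<tau>
      = 8 * ascent_third 2 - 3 * \<tau>"
    by (rule eventually_at_top_linorderI)
  then have "(\<lambda>n. third_centered_moment (\<Omega> n) (P n) - real n * \<tau>) \<in> O(\<lambda>_. 1)"
    by (subst landau_o.big.in_cong) auto
  with 1 2 3 show ?thesis
    unfolding \<tau>_def by blast
qed

end
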